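(* Let $\mathbb{F}$ be any field and let $\beta,\gamma\in\mathbb{F}$ with $\beta\gamma\neq 0$. The subgroups $V_\beta=V(1,1,0,\beta)$ and $V_\gamma=V(1,1,0,\gamma)$ are conjugate in $\mathrm{AGL}_3(\mathbb{F})$ if and only if $\beta=\gamma$.
   Context: $\mathrm{AGL}_3(\mathbb{F})$ is the subgroup of $\mathrm{GL}_4(\mathbb{F})$ consisting of the matrices with first column $(1,0,0,0)^{\mathrm T}$. For $\alpha_2,\alpha_3,\beta_2,\beta_3\in\mathbb{F}$, $$V(\alpha_2,\alpha_3,\beta_2,\beta_3)=\left\{\begin{pmatrix}1&x_1&x_2&x_3\\0&1&0&0\\0&\alpha_2x_2+\alpha_3x_3&1&0\\0&\beta_2x_2+\beta_3x_3&0&1\end{pmatrix}:x_1,x_2,x_3\in\mathbb{F}\right\}\le\mathrm{AGL}_3(\mathbb{F}).$$ *)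

theory Defs
  imports "HOL-Algebra.Coset" "Jordan_Normal_Form.Matrix"
begin

definition GL :: "nat \<Rightarrow> 'a::field mat monoid" where
  "GL n = units_of (ring_mat TYPE('a) n ())"

text \<open>Rows and columns are indexed from \<open>0\<close>, so the first column is \<open>col A 0\<close>; \<open>unit_vec n 0\<close> is
  \<open>(1, 0, \<dots>, 0)\<close> of length \<open>n\<close>.\<close>

definition AGL :: "nat \<Rightarrow> 'a::field mat monoid" where
  "AGL n = (GL (n + 1))\<lparr>carrier := {A \<in> carrier (GL (n + 1)). col A 0 = unit_vec (n + 1) 0}\<rparr>"

definition V_mat :: "'a::field \<Rightarrow> 'a \<Rightarrow> 'a \<Rightarrow> 'a \<Rightarrow> 'a \<Rightarrow> 'a \<Rightarrow> 'a \<Rightarrow> 'a mat" where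
  "V_mat \<alpha>2 \<alpha>3 \<beta>2 \<beta>3 x1 x2 x3 = mat_of_rows_list 4
    [[1, x1, x2, x3],
     [0, 1, 0, 0],
     [0, \<alpha>2 * x2 + \<alpha>3 * x3, 1, 0],
     [0, \<beta>2 * x2 + \<beta>3 * x3, 0, 1]]"

definition V :: "'a::field \<Rightarrow> 'a \<Rightarrow> 'a \<Rightarrow> 'a \<Rightarrow> 'a mat set" where
  "V \<alpha>2 \<alpha>3 \<beta>2 \<beta>3 = {V_mat \<alpha>2 \<alpha>3 \<beta>2 \<beta>3 x1 x2 x3 | x1 x2 x3. True}"

definition conjugate_in :: "('g, 'b) monoid_scheme \<Rightarrow> 'g set \<Rightarrow> 'g set \<Rightarrow> bool" where
  "conjugate_in G H K \<longleftrightarrow>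
    (\<exists>g\<in>carrier G. K = g <#\<^bsub>G\<^esub> (H #>\<^bsub>G\<^esub> inv\<^bsub>G\<^esub> g))"

lemma group_GL: "group (GL n :: 'a::field mat monoid)"
proof -
  interpret ring "ring_mat TYPE('a) n ()" by (rule ring_mat)
  show ?thesis unfolding GL_def by (rule units_group)
qed

lemma GL_simps:
  "Group.monoid.mult (GL n) = (*)" "one (GL n) = 1\<^sub>m n"
  "carrier (GL n) = {A \<in> carrier_mat n n. \<exists>B\<in>carrier_mat n n. B * A = 1\<^sub>m n \<and> A * B = 1\<^sub>m n}"
  by (auto simp: GL_def units_of_def ring_mat_simps Units_def)

lemma subgroup_AGL:
  "subgroup {A \<in> carrier (GL (n + 1)). col A 0 = unit_vec (n + 1) 0} (GL (n + 1) :: 'a::field mat monoid)"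
proof -
  let ?G = "GL (n + 1) :: 'a mat monoid"
  let ?e = "unit_vec (n + 1) 0 :: 'a vec"
  interpret group ?G by (rule group_GL)
  have carr: "A \<in> carrier_mat (n + 1) (n + 1)" if "A \<in> carrier ?G" for A
    using that by (auto simp: GL_simps)
  have col: "col A 0 = A *\<^sub>v ?e" if "A \<in> carrier_mat (n + 1) (n + 1)" for A :: "'a mat"
    using that by auto
  show ?thesis
  proof (rule subgroupI)
    show "{A \<in> carrier ?G. col A 0 = ?e} \<noteq> {}"
      using one_closed by (auto simp: GL_simps(2) intro!: exI[of _ "1\<^sub>m (n + 1)"])
  next
    fix A assume "A \<in> {A \<in> carrier ?G. col A 0 = ?e}"
    then have A: "A \<in> carrier ?G" and e: "A *\<^sub>v ?e = ?e" using col carr by auto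
    let ?B = "inv\<^bsub>?G\<^esub> A"
    have B: "?B \<in> carrier ?G" by (rule inv_closed[OF A])
    have "?B *\<^sub>v ?e = ?B *\<^sub>v (A *\<^sub>v ?e)" using e by simp
    also have "\<dots> = (?B * A) *\<^sub>v ?e"
      using carr[OF A] carr[OF B] by (intro assoc_mult_mat_vec[symmetric]) auto
    also have "?B * A = 1\<^sub>m (n + 1)" using l_inv[OF A] by (simp add: GL_simps)
    finally have "?B *\<^sub>v ?e = ?e" by simp
    then show "?B \<in> {A \<in> carrier ?G. col A 0 = ?e}" using B col[OF carr[OF B]] by simp
  next
    fix A B assume "A \<in> {A \<in> carrier ?G. col A 0 = ?e}" "B \<in> {A \<in> carrier ?G. col A 0 = ?e}"
    then have A: "A \<in> carrier ?G" "A *\<^sub>v ?e = ?e" and B: "B \<in> carrier ?G" "B *\<^sub>v ?e = ?e"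
      using col carr by auto
    have AB: "A \<otimes>\<^bsub>?G\<^esub> B \<in> carrier ?G" by (rule m_closed[OF A(1) B(1)])
    have "(A * B) *\<^sub>v ?e = A *\<^sub>v (B *\<^sub>v ?e)"
      using carr[OF A(1)] carr[OF B(1)] by (intro assoc_mult_mat_vec) auto
    then have "(A \<otimes>\<^bsub>?G\<^esub> B) *\<^sub>v ?e = ?e" using A B by (simp add: GL_simps)
    then show "A \<otimes>\<^bsub>?G\<^esub> B \<in> {A \<in> carrier ?G. col A 0 = ?e}"
      using AB col[OF carr[OF AB]] by simp
  qed auto
qed

lemma group_AGL: "group (AGL n)"
  unfolding AGL_def by (rule group.subgroup_imp_group[OF group_GL subgroup_AGL])

lemma V_mat_dim:
  "dim_row (V_mat a b c d x1 x2 x3) = 4" "dim_col (V_mat a b c d x1 x2 x3) = 4"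
  unfolding V_mat_def mat_of_rows_list_def dim_row_mat dim_col_mat by simp_all

lemma V_mat_carrier: "V_mat a b c d x1 x2 x3 \<in> carrier_mat 4 4"
  by (rule carrier_matI) (rule V_mat_dim)+

lemma V_mat_entry:
  assumes "i < 4" "j < 4"
  shows "V_mat a b c d x1 x2 x3 $$ (i, j) =
    [[1, x1, x2, x3],
     [0, 1, 0, 0],
     [0, a * x2 + b * x3, 1, 0],
     [0, c * x2 + d * x3, 0, 1]] ! i ! j"
proof -
  have "length [[1, x1, x2, x3], [0, 1, 0, 0], [0, a * x2 + b * x3, 1, 0],
     [0, c * x2 + d * x3, 0, 1]] = 4" by simp
  then show ?thesis
    using assms unfolding V_mat_def mat_of_rows_list_def by (simp only: index_mat(1) prod.case)
qed

lemma V_mat_index: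
  "V_mat a b c d x1 x2 x3 $$ (0, 0) = 1"
  "V_mat a b c d x1 x2 x3 $$ (0, 1) = x1"
  "V_mat a b c d x1 x2 x3 $$ (0, 2) = x2"
  "V_mat a b c d x1 x2 x3 $$ (0, 3) = x3"
  "V_mat a b c d x1 x2 x3 $$ (1, 0) = 0"
  "V_mat a b c d x1 x2 x3 $$ (1, 1) = 1"
  "V_mat a b c d x1 x2 x3 $$ (1, 2) = 0"
  "V_mat a b c d x1 x2 x3 $$ (1, 3) = 0"
  "V_mat a b c d x1 x2 x3 $$ (2, 0) = 0"
  "V_mat a b c d x1 x2 x3 $$ (2, 1) = a * x2 + b * x3"
  "V_mat a b c d x1 x2 x3 $$ (2, 2) = 1"
  "V_mat a b c d x1 x2 x3 $$ (2, 3) = 0"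
  "V_mat a b c d x1 x2 x3 $$ (3, 0) = 0"
  "V_mat a b c d x1 x2 x3 $$ (3, 1) = c * x2 + d * x3"
  "V_mat a b c d x1 x2 x3 $$ (3, 2) = 0"
  "V_mat a b c d x1 x2 x3 $$ (3, 3) = 1"
  by (subst V_mat_entry; simp)+

lemma cases_less_4: "i < (4::nat) \<Longrightarrow> i = 0 \<or> i = 1 \<or> i = 2 \<or> i = 3"
  by linarith

lemma atLeastLessThan_4: "{0..<4::nat} = {0, 1, 2, 3}"
  by (simp add: eval_nat_numeral atLeast0_lessThan_Suc insert_commute)

lemma V_mat_mult:
  "V_mat a b c d x1 x2 x3 * V_mat a b c d y1 y2 y3 =
   V_mat a b c d (x1 + y1 + x2 * (a * y2 + b * y3) + x3 * (c * y2 + d * y3)) (x2 + y2) (x3 + y3)"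
  (is "?A * ?B = ?C")
proof (rule eq_matI)
  fix i j assume "i < dim_row ?C" "j < dim_col ?C"
  then have i: "i < 4" and j: "j < 4" by (simp_all add: V_mat_dim)
  have "(?A * ?B) $$ (i, j) = (\<Sum>k\<in>{0, 1, 2, 3}. ?A $$ (i, k) * ?B $$ (k, j))"
    using i j by (simp add: scalar_prod_def V_mat_dim atLeastLessThan_4)
  then show "(?A * ?B) $$ (i, j) = ?C $$ (i, j)"
    using cases_less_4[OF i] cases_less_4[OF j]
    by (elim disjE) (simp_all add: V_mat_index[unfolded One_nat_def] algebra_simps)
qed (simp_all add: V_mat_dim)

lemma V_mat_one: "V_mat a b c d 0 0 (0 :: 'a::field) = 1\<^sub>m 4"
proof (rule eq_matI)
  fix i j assume "i < dim_row (1\<^sub>m 4 :: 'a mat)" "j < dim_col (1\<^sub>m 4 :: 'a mat)"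
  then have i: "i < 4" and j: "j < 4" by simp_all
  show "V_mat a b c d 0 0 0 $$ (i, j) = 1\<^sub>m 4 $$ (i, j)"
    using cases_less_4[OF i] cases_less_4[OF j]
    by (elim disjE) (simp_all only: V_mat_index, simp_all)
qed (simp_all add: V_mat_dim)

lemma V_mat_inverse:
  fixes a b c d x1 x2 x3 :: "'a::field"
  defines "w \<equiv> - x1 + x2 * (a * x2 + b * x3) + x3 * (c * x2 + d * x3)"
  shows "V_mat a b c d w (- x2) (- x3) * V_mat a b c d x1 x2 x3 = 1\<^sub>m 4"
    and "V_mat a b c d x1 x2 x3 * V_mat a b c d w (- x2) (- x3) = 1\<^sub>m 4"
proof -
  have "w + x1 + - x2 * (a * x2 + b * x3) + - x3 * (c * x2 + d * x3) = 0"
    unfolding w_def mult_minus_left by simp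
  then show "V_mat a b c d w (- x2) (- x3) * V_mat a b c d x1 x2 x3 = 1\<^sub>m 4"
    unfolding V_mat_mult add.left_inverse by (simp only: V_mat_one)
  have "a * - x2 + b * - x3 = - (a * x2 + b * x3)" "c * - x2 + d * - x3 = - (c * x2 + d * x3)"
    by simp_all
  then have "x1 + w + x2 * (a * - x2 + b * - x3) + x3 * (c * - x2 + d * - x3) = 0"
    unfolding w_def by (simp only: mult_minus_right) simp
  then show "V_mat a b c d x1 x2 x3 * V_mat a b c d w (- x2) (- x3) = 1\<^sub>m 4"
    unfolding V_mat_mult add.right_inverse by (simp only: V_mat_one)
qed

lemma V_mat_in_AGL: "V_mat a b c d x1 x2 (x3 :: 'a::field) \<in> carrier (AGL 3)"
proof -
  have "col (V_mat a b c d x1 x2 x3) 0 = unit_vec 4 0"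
  proof (rule eq_vecI)
    fix i assume "i < dim_vec (unit_vec 4 0 :: 'a vec)"
    then have i: "i < 4" by simp
    then have "col (V_mat a b c d x1 x2 x3) 0 $ i = V_mat a b c d x1 x2 x3 $$ (i, 0)"
      by (simp add: V_mat_dim)
    then show "col (V_mat a b c d x1 x2 x3) 0 $ i = unit_vec 4 0 $ i"
      using cases_less_4[OF i] by (elim disjE) (simp_all only: V_mat_index, simp_all)
  qed (simp add: V_mat_dim)
  moreover have "\<exists>B\<in>carrier_mat 4 4.
      B * V_mat a b c d x1 x2 x3 = 1\<^sub>m 4 \<and> V_mat a b c d x1 x2 x3 * B = 1\<^sub>m 4"
    by (intro bexI conjI) (rule V_mat_inverse V_mat_carrier)+
  ultimately show ?thesis
    by (simp add: AGL_def GL_simps V_mat_carrier)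
qed

lemma V_mat_in_V: "V_mat a b c d x1 x2 x3 \<in> V a b c d"
  unfolding V_def by blast

lemma V_cases:
  assumes "A \<in> V a b c d"
  obtains x1 x2 x3 where "A = V_mat a b c d x1 x2 x3"
  using assms unfolding V_def by blast

lemma subgroup_V: "subgroup (V a b c (d :: 'a::field)) (AGL 3)"
proof -
  interpret group "AGL 3 :: 'a mat monoid" by (rule group_AGL)
  have m: "Group.monoid.mult (AGL 3 :: 'a mat monoid) = (*)"
    and o: "one (AGL 3 :: 'a mat monoid) = 1\<^sub>m 4"
    by (simp_all add: AGL_def GL_simps)
  show ?thesis
  proof (rule subgroupI)
    show "V a b c d \<subseteq> carrier (AGL 3)" using V_mat_in_AGL by (blast elim: V_cases)
    show "V a b c d \<noteq> {}" using V_mat_in_V by blast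
  next
    fix A assume "A \<in> V a b c d"
    then obtain x1 x2 x3 where A: "A = V_mat a b c d x1 x2 x3" by (rule V_cases)
    have "inv\<^bsub>AGL 3\<^esub> A
      = V_mat a b c d (- x1 + x2 * (a * x2 + b * x3) + x3 * (c * x2 + d * x3)) (- x2) (- x3)"
      by (rule inv_equality) (simp_all only: A m o V_mat_inverse V_mat_in_AGL)
    then show "inv\<^bsub>AGL 3\<^esub> A \<in> V a b c d" by (simp only: V_mat_in_V)
  next
    fix A B assume "A \<in> V a b c d" "B \<in> V a b c d"
    then obtain x1 x2 x3 y1 y2 y3
      where "A = V_mat a b c d x1 x2 x3" "B = V_mat a b c d y1 y2 y3" by (blast elim: V_cases)
    then show "A \<otimes>\<^bsub>AGL 3\<^esub> B \<in> V a b c d" by (simp only: m V_mat_mult V_mat_in_V)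
  qed
qed

end

theory Submission
  imports Defs
begin

text \<open>Suppose \<open>g V\<^sub>\<beta> = V\<^sub>\<gamma> g\<close>. Comparing second rows shows that the second row of \<open>g\<close> is
  \<open>(0, a, 0, 0)\<close> with \<open>a \<noteq> 0\<close>. Comparing the remaining entries gives \<open>B M\<^sub>\<beta> B\<^sup>T = a M\<^sub>\<gamma>\<close>, where \<open>B\<close>
  is the lower right \<open>2 \<times> 2\<close> block of \<open>g\<close> and \<open>M\<^sub>\<beta>\<close> has rows \<open>(1, 1)\<close> and \<open>(0, \<beta>)\<close>. The
  skew-symmetric part \<open>M - M\<^sup>T\<close> yields \<open>det B = a\<close>, and determinants yield
  \<open>\<beta> (det B)\<^sup>2 = a\<^sup>2 \<gamma>\<close>; hence \<open>\<beta> = \<gamma>\<close>.\<close>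

lemma mult_mat_4_index:
  fixes A B :: "'a::semiring_1 mat"
  assumes "A \<in> carrier_mat 4 4" "B \<in> carrier_mat 4 4" "i < 4" "j < 4"
  shows "(A * B) $$ (i, j) =
    A $$ (i, 0) * B $$ (0, j) + A $$ (i, 1) * B $$ (1, j) +
    A $$ (i, 2) * B $$ (2, j) + A $$ (i, 3) * B $$ (3, j)"
  using assms by (simp add: scalar_prod_def atLeastLessThan_4 add.assoc)

lemma AGL_simps:
  "Group.monoid.mult (AGL n) = (*)" "one (AGL n) = 1\<^sub>m (n + 1)"
  by (simp_all add: AGL_def GL_simps)

lemma AGL_carrier_mat: "g \<in> carrier (AGL n) \<Longrightarrow> g \<in> carrier_mat (n + 1) (n + 1)"
  by (auto simp: AGL_def GL_simps)

lemma AGL_index_0: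
  assumes "g \<in> carrier (AGL n)" "i < n + 1"
  shows "g $$ (i, 0) = (if i = 0 then 1 else 0)"
proof -
  have "col g 0 $ i = g $$ (i, 0)"
    using AGL_carrier_mat[OF assms(1)] assms(2) by auto
  moreover have "col g 0 = unit_vec (n + 1) 0"
    using assms(1) by (simp add: AGL_def)
  ultimately show ?thesis using assms(2) by simp
qed

lemma (in group) conjugate_in_refl:
  assumes "H \<subseteq> carrier G"
  shows "conjugate_in G H H"
  unfolding conjugate_in_def using assms
  by (intro bexI[of _ \<one>]) (simp_all add: coset_mult_one lcos_mult_one)

text \<open>Multiplying \<open>K = g H (inv g)\<close> by \<open>g\<close> on the right removes the
  inverse, so only equations bilinear in matrix entries remain.\<close>

lemma (in group) conjugate_inE:
  assumes "conjugate_in G H K" "H \<subseteq> carrier G"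
  obtains g where "g \<in> carrier G"
    and "\<And>h. h \<in> H \<Longrightarrow> \<exists>k\<in>K. k \<otimes> g = g \<otimes> h"
    and "\<And>k. k \<in> K \<Longrightarrow> \<exists>h\<in>H. k \<otimes> g = g \<otimes> h"
proof -
  obtain g where g: "g \<in> carrier G" and K: "K = g <# (H #> inv g)"
    using assms(1) unfolding conjugate_in_def by blast
  then have K: "K = (\<lambda>h. g \<otimes> (h \<otimes> inv g)) ` H"
    by (auto simp: l_coset_def r_coset_def)
  have "g \<otimes> (h \<otimes> inv g) \<otimes> g = g \<otimes> h" if "h \<in> H" for h
    using that g assms(2) by (simp add: m_assoc subset_iff)
  then show ?thesis using that[OF g] K by blast
qed

text \<open>These are the entries (1,1), (0,2), (0,3), (2,1), (3,1), in this order, of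
  \<open>eq\<close>; column 0 of \<open>g\<close> is a unit vector, and terms common to both sides
  cancel.\<close>

lemma V_intertwine_index:
  fixes g :: "'a::field mat"
  assumes g: "g \<in> carrier (AGL 3)"
    and eq: "V_mat 1 1 0 \<gamma> y1 y2 y3 * g = g * V_mat 1 1 0 \<beta> x1 x2 x3"
  shows "(x2 + x3) * g $$ (1, 2) + \<beta> * x3 * g $$ (1, 3) = 0"
    and "y1 * g $$ (1, 2) + y2 * g $$ (2, 2) + y3 * g $$ (3, 2) = x2"
    and "y1 * g $$ (1, 3) + y2 * g $$ (2, 3) + y3 * g $$ (3, 3) = x3"
    and "(x2 + x3) * g $$ (2, 2) + \<beta> * x3 * g $$ (2, 3) = (y2 + y3) * g $$ (1, 1)"
    and "(x2 + x3) * g $$ (3, 2) + \<beta> * x3 * g $$ (3, 3) = \<gamma> * y3 * g $$ (1, 1)"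
proof -
  have g4: "g \<in> carrier_mat 4 4" using AGL_carrier_mat[OF g] by simp
  have g0: "g $$ (0, 0) = 1" "g $$ (1, 0) = 0" "g $$ (2, 0) = 0" "g $$ (3, 0) = 0"
    using AGL_index_0[OF g] by simp_all
  note index = mult_mat_4_index[OF V_mat_carrier g4] mult_mat_4_index[OF g4 V_mat_carrier]
  have E: "(V_mat 1 1 0 \<gamma> y1 y2 y3 * g) $$ (i, j) = (g * V_mat 1 1 0 \<beta> x1 x2 x3) $$ (i, j)" for i j
    by (simp only: eq)
  show "(x2 + x3) * g $$ (1, 2) + \<beta> * x3 * g $$ (1, 3) = 0"
    using E[of 1 1] by (simp add: index V_mat_index[unfolded One_nat_def] g0[unfolded One_nat_def] algebra_simps)
  show "y1 * g $$ (1, 2) + y2 * g $$ (2, 2) + y3 * g $$ (3, 2) = x2"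
    using E[of 0 2] by (simp add: index V_mat_index[unfolded One_nat_def] g0[unfolded One_nat_def] algebra_simps)
  show "y1 * g $$ (1, 3) + y2 * g $$ (2, 3) + y3 * g $$ (3, 3) = x3"
    using E[of 0 3] by (simp add: index V_mat_index[unfolded One_nat_def] g0[unfolded One_nat_def] algebra_simps)
  show "(x2 + x3) * g $$ (2, 2) + \<beta> * x3 * g $$ (2, 3) = (y2 + y3) * g $$ (1, 1)"
    using E[of 2 1] by (simp add: index V_mat_index[unfolded One_nat_def] g0[unfolded One_nat_def] algebra_simps)
  show "(x2 + x3) * g $$ (3, 2) + \<beta> * x3 * g $$ (3, 3) = \<gamma> * y3 * g $$ (1, 1)"
    using E[of 3 1] by (simp add: index V_mat_index[unfolded One_nat_def] g0[unfolded One_nat_def] algebra_simps)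
qed

text \<open>Row 1 of \<open>g\<close> vanishes off the diagonal, so entry (1,1) of
  \<open>g * inv g = 1\<close> is a product with factor \<open>g $$ (1, 1)\<close>.\<close>

lemma AGL_3_index_1_1_nonzero:
  fixes g :: "'a::field mat"
  assumes g: "g \<in> carrier (AGL 3)" and "g $$ (1, 2) = 0" "g $$ (1, 3) = 0"
  shows "g $$ (1, 1) \<noteq> 0"
proof -
  interpret group "AGL 3 :: 'a mat monoid" by (rule group_AGL)
  let ?h = "inv\<^bsub>AGL 3\<^esub> g"
  have g4: "g \<in> carrier_mat 4 4" and h4: "?h \<in> carrier_mat 4 4"
    using AGL_carrier_mat[OF g] AGL_carrier_mat[OF inv_closed[OF g]] by simp_all
  have "g $$ (1, 0) = 0" using AGL_index_0[OF g, of 1] by simp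
  moreover have "(g * ?h) $$ (1, 1) = 1" using r_inv[OF g] by (simp add: AGL_simps)
  ultimately show ?thesis using assms(2,3) by (auto simp: mult_mat_4_index[OF g4 h4])
qed

text \<open>The hypotheses are the entries of the matrix equation \<open>B M\<^sub>\<beta> B\<^sup>T = a M\<^sub>\<gamma>\<close>, where \<open>B\<close> has rows
  \<open>(p, q)\<close> and \<open>(r, s)\<close>.\<close>

lemma congruence_parameter_eq:
  fixes a p q r s \<beta> \<gamma> :: "'a::field"
  assumes e11: "(p + q) * p + \<beta> * q * q = a"
    and e21: "(p + q) * r + \<beta> * q * s = 0"
    and e12: "(r + s) * p + \<beta> * s * q = a"
    and e22: "(r + s) * r + \<beta> * s * s = \<gamma> * a"
    and "a \<noteq> 0"
  shows "\<beta> = \<gamma>"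
proof -
  \<comment> \<open>In the difference of the off-diagonal entries the symmetric part of the form
    cancels, and the skew part scales by the determinant.\<close>
  have "p * s - q * r = ((r + s) * p + \<beta> * s * q) - ((p + q) * r + \<beta> * q * s)"
    by (simp add: algebra_simps)
  then have det: "p * s - q * r = a" by (simp add: e12 e21)
  \<comment> \<open>Multiplicativity of the 2 by 2 determinant, written out as a polynomial
    identity.\<close>
  have "\<beta> * ((p * s - q * r) * (p * s - q * r)) =
      ((p + q) * p + \<beta> * q * q) * ((r + s) * r + \<beta> * s * s)
      - ((r + s) * p + \<beta> * s * q) * ((p + q) * r + \<beta> * q * s)"
    by (simp add: algebra_simps)
  then have "\<beta> * (a * a) = \<gamma> * (a * a)"
    unfolding det e11 e12 e21 e22 by (simp add: algebra_simps)
  then show ?thesis using \<open>a \<noteq> 0\<close> by simp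
qed

theorem lemma7p2:
  fixes \<beta> \<gamma> :: "'a::field"
  assumes "\<beta> * \<gamma> \<noteq> 0"
  shows "conjugate_in (AGL 3) (V 1 1 0 \<beta>) (V 1 1 0 \<gamma>) \<longleftrightarrow> \<beta> = \<gamma>"
proof -
  interpret group "AGL 3 :: 'a mat monoid" by (rule group_AGL)
  have sub: "V 1 1 0 \<beta> \<subseteq> carrier (AGL 3)"
    using subgroup_V by (rule subgroup.subset)
  show ?thesis
  proof
    assume "\<beta> = \<gamma>"
    then show "conjugate_in (AGL 3) (V 1 1 0 \<beta>) (V 1 1 0 \<gamma>)"
      using conjugate_in_refl[OF sub] by simp
  next
    assume "conjugate_in (AGL 3) (V 1 1 0 \<beta>) (V 1 1 0 \<gamma>)"
    then obtain g :: "'a mat" where g: "g \<in> carrier (AGL 3)"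
      and HK: "\<And>h. h \<in> V 1 1 0 \<beta> \<Longrightarrow> \<exists>k\<in>V 1 1 0 \<gamma>. k * g = g * h"
      and KH: "\<And>k. k \<in> V 1 1 0 \<gamma> \<Longrightarrow> \<exists>h\<in>V 1 1 0 \<beta>. k * g = g * h"
      using sub by (rule conjugate_inE) (auto simp: AGL_simps)
    \<comment> \<open>Here \<open>h\<close> is arbitrary in \<open>V 1 1 0 \<beta>\<close>, so
      \<open>x2\<close> and \<open>x3\<close> can be chosen freely.\<close>
    have row1: "(x2 + x3) * g $$ (1, 2) + \<beta> * x3 * g $$ (1, 3) = 0" for x2 x3
      using HK[OF V_mat_in_V[of 1 1 0 \<beta> 0 x2 x3]] V_intertwine_index(1)[OF g]
      by (blast elim: V_cases)
    have g12: "g $$ (1, 2) = 0" using row1[of 1 0] by simp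
    have g13: "g $$ (1, 3) = 0" using row1[of 0 1] g12 assms by simp
    have a: "g $$ (1, 1) \<noteq> 0" using g g12 g13 by (rule AGL_3_index_1_1_nonzero)
    \<comment> \<open>The parameters (0,1,0) and (0,0,1) make \<open>(x2, x3)\<close> and
      \<open>(z2, z3)\<close> the two rows of the block \<open>B\<close>; they yield the first and
      second columns of the congruence.\<close>
    obtain x1 x2 x3 where
      x: "V_mat 1 1 0 \<gamma> 0 1 0 * g = g * V_mat 1 1 0 \<beta> x1 x2 x3"
      using KH[OF V_mat_in_V] by (metis V_cases)
    obtain z1 z2 z3 where
      z: "V_mat 1 1 0 \<gamma> 0 0 1 * g = g * V_mat 1 1 0 \<beta> z1 z2 z3"
      using KH[OF V_mat_in_V] by (metis V_cases)
    note X = V_intertwine_index[OF g x] and Z = V_intertwine_index[OF g z]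
    have x23: "x2 = g $$ (2, 2)" "x3 = g $$ (2, 3)" using X(2,3) by simp_all
    have z23: "z2 = g $$ (3, 2)" "z3 = g $$ (3, 3)" using Z(2,3) by simp_all
    show "\<beta> = \<gamma>"
    proof (rule congruence_parameter_eq[OF _ _ _ _ a])
      show "(g $$ (2, 2) + g $$ (2, 3)) * g $$ (2, 2) + \<beta> * g $$ (2, 3) * g $$ (2, 3) = g $$ (1, 1)"
        using X(4) by (simp add: x23)
      show "(g $$ (2, 2) + g $$ (2, 3)) * g $$ (3, 2) + \<beta> * g $$ (2, 3) * g $$ (3, 3) = 0"
        using X(5) by (simp add: x23)
      show "(g $$ (3, 2) + g $$ (3, 3)) * g $$ (2, 2) + \<beta> * g $$ (3, 3) * g $$ (2, 3) = g $$ (1, 1)"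
        using Z(4) by (simp add: z23)
      show "(g $$ (3, 2) + g $$ (3, 3)) * g $$ (3, 2) + \<beta> * g $$ (3, 3) * g $$ (3, 3) = \<gamma> * g $$ (1, 1)"
        using Z(5) by (simp add: z23)
    qed
  qed
qed

end
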